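(* If $n$ is a non-negative integer, then $$\sum_{k=0}^\infty \frac{\left(\frac12\right)_k^3}{4^k\,k!^3}\,\frac{\prod_{j=1}^{2n}(2k+j)}{\prod_{j=1}^n (k+j)^2(2k-2j+1)}\,\Bigl((6k+1+2n)\bigl(2O_{k-n}-2O_{k+n}+H_{k+n}\bigr)-2\Bigr)=(-1)^n\,\frac{2^{n+3}}{\left(\frac12\right)_n}\,\left(O_n-\ln 2\right)\frac1\pi.$$ In particular, $$\sum_{k=0}^\infty \frac{\left(\frac12\right)_k^3}{4^k\,k!^3}\,\bigl((6k+1)H_k-2\bigr)=-\frac{8\ln 2}{\pi}.$$
   Context: $(x)_n=\prod_{j=0}^{n-1}(x+j)$ is the Pochhammer symbol; empty products equal $1$, and $\prod_{j=1}^n (k+j)^2(2k-2j+1)$ extends over both factors. For non-negative integers $j$, $H_j=\sum_{i=1}^j \frac1i$ and $O_j=\sum_{i=1}^j\frac1{2i-1}$, with $H_0=O_0=0$. For complex $z$ that is not a negative integer, $H_z=\psi(z+1)+\gamma$, where $\psi$ is the digamma function and $\gamma$ is Euler's constant. For negative integers $j$, $O_j$ is defined by the relation $H_{j-1/2}=2O_j-2\ln 2$ (which holds for non-negative $j$); equivalently $O_{-j}=O_j$ for all integers $j$. *)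

theory Defs
  imports "HOL-Analysis.Analysis"
begin

text \<open>
  The harmonic number at a real or complex argument that is not a negative integer;
  at non-negative integers it agrees with the library function \<open>harm\<close>.
\<close>

definition harmonic :: "'a :: {real_normed_field, banach} \<Rightarrow> 'a" where
  "harmonic z = Digamma (z + 1) + euler_mascheroni"

text \<open>
  The odd harmonic number \<open>O\<^sub>j\<close>. For negative \<open>j\<close> it is the solution of
  \<open>H\<^bsub>j - 1/2\<^esub> = 2 O\<^sub>j - 2 ln 2\<close>.
\<close>

definition odd_harm :: "int \<Rightarrow> real" where
  "odd_harm j =
     (if j \<ge> 0 then \<Sum>i=1..nat j. 1 / (2 * real i - 1)
      else (harmonic (of_int j - 1 / 2) + 2 * ln 2) / 2)"

end

theory Submission
  imports Defs "HOL-Complex_Analysis.Complex_Analysis"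
begin

text \<open>
  The harmonic numbers in the series arise from differentiating, with respect to \<open>n\<close>, a simpler
  series whose coefficients are products of Gamma functions. Replace \<open>n\<close> by a complex variable
  \<open>x\<close> and put
  \<open>t k x = (1/2)\<^sub>k (1/2 - x)\<^sub>k / (4\<^sup>k k!\<^sup>2) * Gamma (x + k + 1/2) / Gamma (x + k + 1) * (6 k + 1 + 2 x)\<close>.
  The claim is that \<open>p x = (\<Sum>k. t k x)\<close> does not depend on \<open>x\<close> and equals \<open>4 / sqrt pi\<close>
  (\<open>shifted_sum_eq\<close>). Differentiating term by term then gives \<open>(\<Sum>k. t' k n) = 0\<close>, where
  \<open>t' k n\<close> is the derivative in \<open>x\<close> at \<open>n\<close>. The logarithmic
  derivative of \<open>t k\<close> at \<open>n\<close> consists of Digamma values at integers and half-integers, which are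
  the harmonic and odd harmonic numbers of the statement up to constants; those constants are
  removed by adding a multiple of \<open>(\<Sum>k. t k n) = 4 / sqrt pi\<close> (\<open>digamma_weighted_sum\<close>).

  Why \<open>p\<close> is constant: a Wilf--Zeilberger certificate (\<open>sum_shifted_term_telescopes\<close>) shows
  \<open>p (x + 1) = p x\<close>. Moreover \<open>p\<close> is holomorphic on a right half-plane and grows at most like
  \<open>(3/2) powr \<bar>Im x\<bar>\<close>, since its terms are dominated by those of a binomial series
  (\<open>shifted_sum_exponential_type\<close>). A function of period one that grows so slowly is constant
  (\<open>periodic_of_small_exponential_type_constant\<close>), a fact of the type of Carlson's theorem. Its
  value is read off at \<open>x = 1/2\<close>, where the series terminates after its first term.
\<close>

section \<open>Periodic functions of small exponential type\<close>

text \<open>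
  As \<open>f\<close> has period one, Rolle's theorem makes the real part of any rotation of \<open>g = f'\<close> vanish
  somewhere on each horizontal segment of length one. Centring that segment at a translate of \<open>z\<close> puts the zero
  within distance \<open>1/2\<close> of it, and this is where the factor \<open>1/2\<close> comes from.
\<close>

lemma norm_deriv_le_half_bound_second_deriv:
  fixes f g h :: "complex \<Rightarrow> complex"
  assumes f: "\<And>w. c < Re w \<Longrightarrow> (f has_field_derivative g w) (at w)"
    and g: "\<And>w. c < Re w \<Longrightarrow> (g has_field_derivative h w) (at w)"
    and per: "\<And>w. c < Re w \<Longrightarrow> f (w + 1) = f w" "\<And>w. c < Re w \<Longrightarrow> g (w + 1) = g w"
    and bd: "\<And>w. c < Re w \<Longrightarrow> Im w = Im z \<Longrightarrow> norm (h w) \<le> M"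
    and z: "c < Re z"
  shows "norm (g z) \<le> M / 2"
proof -
  \<comment> \<open>Rotating by this unit makes the real part of \<open>e * g z\<close> the full modulus of \<open>g z\<close>.\<close>
  define e where "e = cnj (sgn (g z))"
  have e: "e * g z = of_real (norm (g z))" and e1: "norm e \<le> 1"
    by (simp_all add: e_def sgn_eq complex_norm_square mult.commute norm_divide
        power2_eq_square flip: complex_norm_square)
  define u where "u s = Re (e * f (z + 1/2 + of_real s))" for s :: real
  have du: "(u has_real_derivative Re (e * g (z + 1/2 + of_real s))) (at s)" if "0 \<le> s" for s
  proof -
    have "((\<lambda>s. e * f (z + 1/2 + of_real s)) has_vector_derivative e * g (z + 1/2 + of_real s)) (at s)"
      using z that
      by (auto intro!: derivative_eq_intros has_vector_derivative_real_field
           DERIV_chain'[where f="\<lambda>s. z + 1/2 + s" and g=f and D=1, simplified] f)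
    then show ?thesis
      unfolding u_def has_real_derivative_iff_has_vector_derivative
      by (rule bounded_linear.has_vector_derivative[OF bounded_linear_Re])
  qed
  have "\<exists>s>0. s < 1 \<and> DERIV u s :> 0"
  proof (rule Rolle)
    show "u 0 = u 1" using per(1)[of "z + 1/2"] z by (simp add: u_def add.assoc)
    show "continuous_on {0..1} u"
      by (rule continuous_at_imp_continuous_on) (auto intro!: DERIV_isCont du)
    show "u differentiable (at x)" if "0 < x" for x
      using du[of x] that real_differentiable_def by auto
  qed auto
  then obtain s where s: "0 < s" "s < 1" "DERIV u s :> 0" by blast
  define \<xi> where "\<xi> = z + 1/2 + of_real s"
  have \<xi>0: "Re (e * g \<xi>) = 0"
    using DERIV_unique[OF s(3) du[of s]] s(1) by (simp add: \<xi>_def)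
  have "norm (g (z + 1) - g \<xi>) \<le> M * norm ((z + 1) - \<xi>)"
  proof (rule field_differentiable_bound[where S="{w. c < Re w} \<inter> {w. Im w = Im z}" and f'=h])
    have "{w. Im w = Im z} = {w. \<i> \<bullet> w = Im z}" by (auto simp: inner_complex_def)
    then have "convex {w. Im w = Im z}" using convex_hyperplane by metis
    then show "convex ({w. c < Re w} \<inter> {w. Im w = Im z})"
      by (intro convex_Int convex_halfspace_Re_gt)
  qed (use z s bd in \<open>auto simp: \<xi>_def intro: has_field_derivative_at_within g\<close>)
  also have "\<dots> \<le> M * (1/2)"
  proof (rule mult_left_mono)
    have "(z + 1) - \<xi> = of_real (1/2 - s)" by (simp add: \<xi>_def)
    then show "norm ((z + 1) - \<xi>) \<le> 1/2" using s by (simp only: norm_of_real)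
    show "0 \<le> M" using bd[OF z refl] norm_ge_zero order_trans by blast
  qed
  finally have d: "norm (g (z + 1) - g \<xi>) \<le> M / 2" by simp
  have "norm (g z) = Re (e * g (z + 1))" using e per(2)[OF z] by simp
  also have "\<dots> = Re (e * (g (z + 1) - g \<xi>))" using \<xi>0 by (simp add: algebra_simps)
  also have "\<dots> \<le> norm e * norm (g (z + 1) - g \<xi>)" by (metis complex_Re_le_cmod norm_mult)
  also have "\<dots> \<le> 1 * (M / 2)" using d e1 by (intro mult_mono) auto
  finally show ?thesis by simp
qed

lemma periodic_shift_nat:
  assumes "\<And>w. c < Re w \<Longrightarrow> f (w + 1) = f w" and "c < Re w"
  shows "f (w + of_nat N) = f w"
proof (induction N)
  case (Suc N)
  then show ?case using assms(1)[of "w + of_nat N"] assms(2) by (simp add: add_ac)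
qed simp

text \<open>
  Each differentiation gains a factor \<open>1/2\<close> by the preceding lemma, while the Cauchy estimate on a
  disc of radius \<open>m\<close> loses only \<open>q ^ m\<close> for the \<open>m\<close>-th derivative; such a disc fits into the
  half-plane after a translation by a large integer. As \<open>q < 2\<close>, the first derivative has to
  vanish. Some bound on \<open>q\<close> is unavoidable, as \<open>exp (2 * pi * \<i> * w)\<close> shows.
\<close>

lemma periodic_of_small_exponential_type_constant:
  fixes f :: "complex \<Rightarrow> complex"
  assumes hol: "f holomorphic_on {w. c < Re w}"
    and per: "\<And>w. c < Re w \<Longrightarrow> f (w + 1) = f w"
    and q: "1 \<le> q" "q < 2"
    and bd: "\<And>w. c < Re w \<Longrightarrow> norm (f w) \<le> C * q powr \<bar>Im w\<bar>"
  shows "f constant_on {w. c < Re w}"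
proof -
  let ?U = "{w. c < Re w}"
  let ?D = "\<lambda>m. (deriv ^^ m) f"
  have op: "open ?U" by (rule open_halfspace_Re_gt)
  have holD: "?D m holomorphic_on ?U" for m by (rule holomorphic_higher_deriv[OF hol op])
  have derD: "(?D m has_field_derivative ?D (Suc m) w) (at w)" if "c < Re w" for m w
    using holomorphic_derivI[OF holD[of m] op] that by simp
  have perD: "?D m (w + 1) = ?D m w" if "c < Re w" for m w
    using that
  proof (induction m arbitrary: w)
    case 0 then show ?case using per by simp
  next
    case (Suc m)
    have "((\<lambda>w. ?D m (w + 1)) has_field_derivative ?D (Suc m) (w + 1)) (at w)"
      using derD[of "w + 1" m] Suc.prems by (simp add: DERIV_shift)
    then have "(?D m has_field_derivative ?D (Suc m) (w + 1)) (at w)"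
      by (rule has_field_derivative_transform_within_open[OF _ op]) (use Suc in auto)
    then show ?case using derD[OF Suc.prems] DERIV_unique by blast
  qed
  have C: "0 \<le> C" 
  proof -
    have "0 \<le> C * q powr \<bar>Im (of_real (c + 1))\<bar>"
      using bd[of "of_real (c + 1)"] norm_ge_zero order_trans by (metis Re_complex_of_real less_add_one)
    then show ?thesis using q by simp
  qed
  have bdD: "norm (?D m w) \<le> C * q powr (\<bar>Im w\<bar> + m)" if w: "c < Re w" and m: "m > 0" for m w
  proof -
    obtain N :: nat where N: "of_nat N > real m" using reals_Archimedean2 by blast
    let ?v = "w + of_nat N"
    have sub: "cball ?v m \<subseteq> ?U"
    proof
      fix x assume "x \<in> cball ?v m"
      then have "\<bar>Re (?v - x)\<bar> \<le> m" using abs_Re_le_cmod[of "?v - x"] by (simp add: dist_norm)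
      then show "x \<in> ?U" using w N by simp
    qed
    have "norm (?D m ?v) \<le> fact m * (C * q powr (\<bar>Im w\<bar> + m)) / real m ^ m"
    proof (rule Cauchy_inequality)
      show "f holomorphic_on ball ?v m"
        using hol sub by (meson ball_subset_cball holomorphic_on_subset order_trans)
      show "continuous_on (cball ?v m) f"
        using hol sub holomorphic_on_imp_continuous_on holomorphic_on_subset by blast
      fix x assume x: "norm (?v - x) = real m"
      then have "x \<in> cball ?v m" by (simp add: dist_norm)
      then have "x \<in> ?U" using sub by blast
      then have "norm (f x) \<le> C * q powr \<bar>Im x\<bar>" using bd by blast
      also have "\<bar>Im x\<bar> \<le> \<bar>Im w\<bar> + m" using abs_Im_le_cmod[of "?v - x"] x by simp
      finally show "norm (f x) \<le> C * q powr (\<bar>Im w\<bar> + m)"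
        using C q by (smt (verit) mult_left_mono powr_mono)
    qed (use m in simp)
    also have "\<dots> = (fact m / real m ^ m) * (C * q powr (\<bar>Im w\<bar> + m))" by simp
    also have "\<dots> \<le> 1 * (C * q powr (\<bar>Im w\<bar> + m))"
    proof (intro mult_right_mono)
      have "fact m \<le> (of_nat (m ^ m) :: real)" by (rule fact_le_power)
      then show "fact m / real m ^ m \<le> 1" using m by (simp add: divide_le_eq_1)
    qed (use C in auto)
    finally show ?thesis using periodic_shift_nat[of c "?D m" w N] perD w by simp
  qed
  have halve: "norm (?D 1 w) \<le> M / 2 ^ m"
    if w: "c < Re w" and M: "\<And>v. c < Re v \<Longrightarrow> Im v = Im w \<Longrightarrow> norm (?D (Suc m) v) \<le> M" for w m M
    using M
  proof (induction m arbitrary: M)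
    case 0 then show ?case using w by auto
  next
    case (Suc m)
    have "norm (?D (Suc m) v) \<le> M / 2" if "c < Re v" "Im v = Im w" for v
      by (rule norm_deriv_le_half_bound_second_deriv[OF derD[of _ m] derD[of _ "Suc m"] perD perD])
         (use that Suc.prems in auto)
    from Suc.IH[OF this] show ?case by simp
  qed
  have zero: "?D 1 w = 0" if w: "c < Re w" for w
  proof -
    define K where "K = C * q powr (\<bar>Im w\<bar> + 1)"
    have le: "norm (?D 1 w) \<le> K * (q / 2) ^ m" for m
    proof -
      have "norm (?D 1 w) \<le> C * q powr (\<bar>Im w\<bar> + Suc m) / 2 ^ m"
        by (rule halve[OF w]) (metis bdD zero_less_Suc)
      also have "q powr (\<bar>Im w\<bar> + Suc m) = q powr (\<bar>Im w\<bar> + 1) * q ^ m"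
        using q by (simp add: powr_add powr_realpow)
      finally show ?thesis by (simp add: K_def power_divide mult.assoc)
    qed
    have "(\<lambda>m. K * (q / 2) ^ m) \<longlonglongrightarrow> K * 0"
      using q by (intro tendsto_intros LIMSEQ_power_zero) auto
    then have "norm (?D 1 w) \<le> K * 0"
      by (rule LIMSEQ_le_const) (use le in auto)
    then show ?thesis by simp
  qed
  have "\<exists>k. \<forall>w\<in>?U. f w = k"
  proof (rule has_field_derivative_zero_constant[OF convex_halfspace_Re_gt])
    show "(f has_field_derivative 0) (at w within ?U)" if "w \<in> ?U" for w
      using derD[of w 0] zero[of w] that by (auto intro: has_field_derivative_at_within)
  qed
  then show ?thesis by (auto simp: constant_on_def)
qed

section \<open>Quotients of Gamma values on half-planes\<close>

lemma not_nonpos_Ints_complex_Re_pos: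
  "0 < Re u \<Longrightarrow> u \<notin> \<int>\<^sub>\<le>\<^sub>0"
  by (auto elim!: nonpos_Ints_cases)

lemma Gamma_series_quotient:
  fixes u :: "'a :: {banach, real_normed_field}"
  shows "Gamma_series u n / Gamma_series (u + of_real \<delta>) n =
      of_real (exp (- \<delta> * ln n)) * (\<Prod>j\<le>n. (u + of_real \<delta> + of_nat j) / (u + of_nat j))"
proof -
    have "exp (u * of_real (ln n)) / exp ((u + of_real \<delta>) * of_real (ln n))
        = of_real (exp (- \<delta> * ln n))"
      by (simp add: algebra_simps flip: exp_diff exp_of_real)
    moreover have "pochhammer (u + of_real \<delta>) (n + 1) / pochhammer u (n + 1)
        = (\<Prod>j\<le>n. (u + of_real \<delta> + of_nat j) / (u + of_nat j))"
      by (simp add: pochhammer_Suc_prod prod_dividef atMost_atLeast0)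
    moreover have "Gamma_series u n / Gamma_series (u + of_real \<delta>) n =
       (exp (u * of_real (ln n)) / exp ((u + of_real \<delta>) * of_real (ln n))) *
       (pochhammer (u + of_real \<delta>) (n + 1) / pochhammer u (n + 1))"
      by (simp add: Gamma_series_def)
    ultimately show ?thesis by simp
qed

text \<open>
  In Euler's product for the quotient, every factor \<open>1 + \<delta> / (w + j)\<close> is at most
  \<open>1 + \<delta> / (\<sigma> + j)\<close> in modulus, which bounds the quotient on a half-plane without Stirling's formula.
\<close>

lemma norm_Gamma_quotient_le:
  fixes w :: complex and \<sigma> \<delta> :: real
  assumes \<sigma>: "0 < \<sigma>" "\<sigma> \<le> Re w" and \<delta>: "0 \<le> \<delta>"
  shows "norm (Gamma w / Gamma (w + of_real \<delta>)) \<le> Gamma \<sigma> / Gamma (\<sigma> + \<delta>)"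
proof -
  have factor: "norm ((w + of_real \<delta> + of_nat j) / (w + of_nat j)) \<le> (\<sigma> + \<delta> + j) / (\<sigma> + j)" for j :: nat
  proof -
    have re: "\<sigma> + j \<le> norm (w + of_nat j)"
      using complex_Re_le_cmod[of "w + of_nat j"] \<sigma> by simp
    then have ne: "w + of_nat j \<noteq> 0" using \<sigma> by auto
    have "(w + of_real \<delta> + of_nat j) / (w + of_nat j) = 1 + of_real \<delta> / (w + of_nat j)"
      using ne by (simp add: field_simps)
    also have "norm \<dots> \<le> 1 + \<delta> / norm (w + of_nat j)"
      using norm_triangle_ineq[of 1 "of_real \<delta> / (w + of_nat j)"] \<delta> by (simp add: norm_divide)
    also have "\<dots> \<le> 1 + \<delta> / (\<sigma> + j)"
      using re \<sigma> \<delta> by (intro add_left_mono frac_le) auto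
    also have "\<dots> = (\<sigma> + \<delta> + j) / (\<sigma> + j)" using \<sigma> by (simp add: field_simps)
    finally show ?thesis .
  qed
  have ne: "Gamma (w + of_real \<delta>) \<noteq> 0" "Gamma (\<sigma> + \<delta>) \<noteq> 0"
    using not_nonpos_Ints_complex_Re_pos[of "w + of_real \<delta>"] \<sigma> \<delta> Gamma_real_pos[of "\<sigma> + \<delta>"]
    by (auto simp: Gamma_eq_zero_iff)
  have lim1: "(\<lambda>n. norm (Gamma_series w n / Gamma_series (w + of_real \<delta>) n))
      \<longlonglongrightarrow> norm (Gamma w / Gamma (w + of_real \<delta>))"
    using ne by (intro tendsto_intros)
  have lim2: "(\<lambda>n. Gamma_series \<sigma> n / Gamma_series (\<sigma> + \<delta>) n) \<longlonglongrightarrow> Gamma \<sigma> / Gamma (\<sigma> + \<delta>)"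
    using ne by (intro tendsto_intros)
  show ?thesis
  proof (rule LIMSEQ_le[OF lim1 lim2], intro exI allI impI)
    fix n :: nat
    show "norm (Gamma_series w n / Gamma_series (w + of_real \<delta>) n)
        \<le> Gamma_series \<sigma> n / Gamma_series (\<sigma> + \<delta>) n"
      unfolding Gamma_series_quotient Gamma_series_quotient[where u=\<sigma>, simplified of_real_eq_id id_apply]
      unfolding norm_mult prod_norm[symmetric]
      by (intro mult_mono prod_mono conjI factor norm_ge_zero prod_nonneg) auto
  qed
qed

section \<open>The interpolating series and its telescoping certificate\<close>

text \<open>
  For \<open>x = n\<close> this is, up to a factor free of \<open>k\<close>, the coefficient in the series to be summed
  (see \<open>summand_weight_eq_shifted_base\<close>); the variable \<open>x\<close> interpolates \<open>n\<close>. The factor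
  \<open>pochhammer (1/2 - x) k\<close> is used in place of \<open>Gamma (1/2 - x + k)\<close> to have no poles on the right.
\<close>

definition shifted_base :: "nat \<Rightarrow> 'a :: Gamma \<Rightarrow> 'a" where
  "shifted_base k x = pochhammer (1/2) k * pochhammer (1/2 - x) k / (4 ^ k * fact k ^ 2)
     * (Gamma (x + of_nat k + 1/2) / Gamma (x + of_nat k + 1))"

definition shifted_term :: "nat \<Rightarrow> 'a :: Gamma \<Rightarrow> 'a" where
  "shifted_term k x = shifted_base k x * (6 * of_nat k + 1 + 2 * x)"

lemma shifted_base_Suc:
  fixes x :: complex assumes "- 1/2 < Re x"
  shows "shifted_base (Suc k) x = shifted_base k x *
     ((of_nat k + 1/2) * (of_nat k + 1/2 - x) * (x + of_nat k + 1/2)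
       / (4 * (of_nat k + 1)\<^sup>2 * (x + of_nat k + 1)))"
proof -
  have "Gamma (x + of_nat (Suc k) + 1/2) = (x + of_nat k + 1/2) * Gamma (x + of_nat k + 1/2)"
    using Gamma_plus1[of "x + of_nat k + 1/2"] not_nonpos_Ints_complex_Re_pos[of "x + of_nat k + 1/2"] assms
    by (simp add: add_ac)
  moreover have "Gamma (x + of_nat (Suc k) + 1) = (x + of_nat k + 1) * Gamma (x + of_nat k + 1)"
    using Gamma_plus1[of "x + of_nat k + 1"] not_nonpos_Ints_complex_Re_pos[of "x + of_nat k + 1"] assms
    by (simp add: add_ac)
  ultimately show ?thesis
    unfolding shifted_base_def pochhammer_rec' fact_Suc power_Suc
    by (simp add: power2_eq_square mult_ac add_ac add_diff_eq)
qed

lemma shifted_base_Suc_shift: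
  fixes x :: complex assumes "- 1/2 < Re x"
  shows "shifted_base (Suc k) (x + 1) = shifted_base k x *
     ((of_nat k + 1/2) * (- 1/2 - x) * (x + of_nat k + 1/2) * (x + of_nat k + 3/2)
       / (4 * (of_nat k + 1)\<^sup>2 * (x + of_nat k + 1) * (x + of_nat k + 2)))"
proof -
  have a: "Gamma (x + 1 + of_nat (Suc k) + 1/2)
      = (x + of_nat k + 3/2) * (x + of_nat k + 1/2) * Gamma (x + of_nat k + 1/2)"
    using Gamma_plus1[of "x + of_nat k + 1/2"] not_nonpos_Ints_complex_Re_pos[of "x + of_nat k + 1/2"]
      Gamma_plus1[of "x + of_nat k + 1/2 + 1"] not_nonpos_Ints_complex_Re_pos[of "x + of_nat k + 1/2 + 1"] assms
    by (simp add: add_ac mult_ac)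
  have b: "Gamma (x + 1 + of_nat (Suc k) + 1)
      = (x + of_nat k + 2) * (x + of_nat k + 1) * Gamma (x + of_nat k + 1)"
    using Gamma_plus1[of "x + of_nat k + 1"] not_nonpos_Ints_complex_Re_pos[of "x + of_nat k + 1"]
      Gamma_plus1[of "x + of_nat k + 1 + 1"] not_nonpos_Ints_complex_Re_pos[of "x + of_nat k + 1 + 1"] assms
    by (simp add: add_ac mult_ac)
  have c: "pochhammer (1/2 - (x + 1)) (Suc k) = (- 1/2 - x) * pochhammer (1/2 - x) k"
    by (simp add: pochhammer_rec add.commute diff_diff_eq2)
  show ?thesis
    unfolding shifted_base_def a b c pochhammer_rec'[of "1/2 :: complex"] fact_Suc power_Suc
    by (simp add: power2_eq_square mult_ac add_ac) (intro disjI2; simp add: algebra_simps)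
qed

text \<open>
  The Wilf--Zeilberger pair behind the summation. For \<open>x + 1/2\<close> not an integer and
  \<open>G k = 8 * k\<^sup>2 * shifted_base k x / (k - 1/2 - x)\<close> the difference in \<open>x\<close> on the left equals
  \<open>G (k + 1) - G k\<close>, and \<open>G 0 = 0\<close>. The right-hand side is \<open>G (N + 1)\<close>, rewritten in terms of
  \<open>shifted_base N x\<close> so that it has no denominator vanishing at half-integers.
\<close>

lemma sum_shifted_term_telescopes:
  fixes x :: complex assumes x: "- 1/2 < Re x"
  shows "(\<Sum>k\<le>N. shifted_term k (x + 1) - shifted_term k x) =
     shifted_base N x * (2 * (of_nat N + 1/2) * (x + of_nat N + 1/2) / (x + of_nat N + 1))"
proof (induction N)
  case 0
  have ne: "x + 1/2 \<notin> \<int>\<^sub>\<le>\<^sub>0" "x + 1 \<notin> \<int>\<^sub>\<le>\<^sub>0" using x by (auto intro!: not_nonpos_Ints_complex_Re_pos)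
  then have ne': "x + 1 \<noteq> 0" "x + 1/2 \<noteq> 0" by auto
  have "shifted_base 0 (x + 1) = shifted_base 0 x * ((x + 1/2) / (x + 1))"
    using Gamma_plus1[OF ne(1)] Gamma_plus1[OF ne(2)] by (simp add: shifted_base_def add_ac mult_ac)
  then have "shifted_term 0 (x + 1) - shifted_term 0 x =
     shifted_base 0 x * ((x + 1/2) / (x + 1) * (2 * x + 3) - (2 * x + 1))"
    by (simp add: shifted_term_def algebra_simps)
  also have "(x + 1/2) / (x + 1) * (2 * x + 3) - (2 * x + 1) = (x + 1/2) / (x + 1)"
  proof -
    have "((x + 1/2) * (2 * x + 3) - (2 * x + 1) * (x + 1)) / (x + 1) = (x + 1/2) / (x + 1)"
      by (simp add: algebra_simps)
    then show ?thesis using ne'(1) by (simp add: diff_divide_distrib)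
  qed
  finally show ?case by simp
next
  case (Suc N)
  define n where "n = (of_nat N :: complex)"
  have re: "Re (n + 1) > 0" "Re (x + n + 1) > 0" "Re (x + n + 2) > 0" using x by (auto simp: n_def)
  then have ne: "n + 1 \<noteq> 0" "x + n + 1 \<noteq> 0" "x + n + 2 \<noteq> 0"
    by (metis less_irrefl zero_complex.sel(1))+
  \<comment> \<open>The common factors are kept abstract, so that only a cubic polynomial identity remains.\<close>
  have combine: "2 * E / A + (E * q / (4 * m * A * C) * t' - E * p / (4 * m * A) * t) = E * p / (4 * m * A) * (r / C)"
    if "m \<noteq> 0" "A \<noteq> 0" "C \<noteq> 0" and key: "8 * m * C + q * t' - p * t * C = p * r"
    for E A m C p q r t t' :: complex
  proof -
    have "2 * E / A + (E * q / (4 * m * A * C) * t' - E * p / (4 * m * A) * t)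
       = E * (8 * m * C + q * t' - p * t * C) / (4 * m * A * C)"
      using that(1-3) by (simp add: field_simps)
    then show ?thesis unfolding key by simp
  qed
  define E where "E = (n + 1/2) * (x + n + 1/2)"
  define r where "r = 2 * (n + 1 + 1/2) * (x + (n + 1) + 1/2)"
  define t where "t = 6 * (n + 1) + 1 + 2 * x"
  define t' where "t' = 6 * (n + 1) + 1 + 2 * (x + 1)"
  have key: "8 * (n + 1)\<^sup>2 * (x + n + 2) + (- 1/2 - x) * (x + n + 3/2) * t' - (n + 1/2 - x) * t * (x + n + 2)
      = (n + 1/2 - x) * r"
    unfolding r_def t_def t'_def by (simp add: field_simps power2_eq_square)
  have P: "shifted_base (Suc N) x = shifted_base N x * (E * (n + 1/2 - x) / (4 * (n + 1)\<^sup>2 * (x + n + 1)))"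
    using shifted_base_Suc[OF x, of N] by (simp add: E_def n_def mult_ac)
  have Q: "shifted_base (Suc N) (x + 1) = shifted_base N x *
      (E * ((- 1/2 - x) * (x + n + 3/2)) / (4 * (n + 1)\<^sup>2 * (x + n + 1) * (x + n + 2)))"
    using shifted_base_Suc_shift[OF x, of N] by (simp add: E_def n_def mult_ac)
  have T: "shifted_term (Suc N) x = shifted_base (Suc N) x * t"
     "shifted_term (Suc N) (x + 1) = shifted_base (Suc N) (x + 1) * t'"
    by (simp_all add: shifted_term_def t_def t'_def n_def add_ac)
  have "(\<Sum>k\<le>Suc N. shifted_term k (x + 1) - shifted_term k x)
      = shifted_base N x * (2 * E / (x + n + 1)) + (shifted_term (Suc N) (x + 1) - shifted_term (Suc N) x)"
    using Suc.IH by (simp add: E_def n_def mult.assoc)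
  also have "\<dots> = shifted_base N x * (2 * E / (x + n + 1)
      + (E * ((- 1/2 - x) * (x + n + 3/2)) / (4 * (n + 1)\<^sup>2 * (x + n + 1) * (x + n + 2)) * t'
        - E * (n + 1/2 - x) / (4 * (n + 1)\<^sup>2 * (x + n + 1)) * t))"
    unfolding T P Q by (simp only: distrib_left right_diff_distrib mult.assoc)
  also have "\<dots> = shifted_base (Suc N) x * (r / (x + n + 2))"
    unfolding P using combine[OF _ ne(2,3) key] ne(1) by (simp only: mult.assoc) simp
  finally show ?case by (simp add: r_def n_def add_ac)
qed

section \<open>Domination by a binomial series\<close>

lemma norm_pochhammer_le:
  fixes w :: "'a :: real_normed_field"
  assumes "norm w \<le> a" shows "norm (pochhammer w k) \<le> pochhammer a k"
proof (induction k)
  case (Suc k)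
  have "norm (w + of_nat k) \<le> a + real k"
    using norm_triangle_ineq[of w "of_nat k"] assms by simp
  moreover have "0 \<le> a" using assms norm_ge_zero order_trans by blast
  ultimately show ?case using Suc by (simp add: pochhammer_rec' norm_mult mult_mono')
qed simp

lemma pochhammer_half_le_fact: "pochhammer (1/2) k \<le> (fact k :: real)"
  using norm_pochhammer_le[of "1/2 :: real" 1 k] pochhammer_nonneg[of "1/2 :: real" k]
  by (simp add: pochhammer_fact)

text \<open>The bound for \<open>Gamma w / Gamma (w + 1/2)\<close> on \<open>Re w \<ge> 1/4\<close>.\<close>

abbreviation gquot :: real where "gquot \<equiv> Gamma (1/4) / Gamma (3/4)"

text \<open>
  The linear factor is absorbed by \<open>(a + k) * pochhammer a k = a * pochhammer (a + 1) k\<close>, so that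
  the majorant is a binomial series with a closed form.
\<close>

lemma norm_shifted_term_le:
  assumes z: "- 1/4 \<le> Re z" and a: "norm z + 1/2 \<le> a"
  shows "norm (shifted_term k z) \<le> 6 * gquot * a * (pochhammer (a + 1) k / fact k * (1/4) ^ k)"
proof -
  have a0: "0 < a" using a norm_ge_zero[of z] by linarith
  have 1: "norm (pochhammer (1/2 :: complex) k) \<le> fact k"
    using norm_pochhammer_le[of "1/2 :: complex" "1/2" k] pochhammer_half_le_fact[of k]
    by simp
  have 2: "norm (pochhammer (1/2 - z) k) \<le> pochhammer a k"
    by (rule norm_pochhammer_le) (use norm_triangle_ineq4[of "1/2" z] a in simp)
  have 3: "norm (Gamma (z + of_nat k + 1/2) / Gamma (z + of_nat k + 1)) \<le> gquot"
    using norm_Gamma_quotient_le[of "1/4" "z + of_nat k + 1/2" "1/2"] z by (simp add: add.assoc)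
  have 4: "norm (6 * of_nat k + 1 + 2 * z) \<le> 6 * (a + k)"
    using norm_triangle_ineq[of "6 * of_nat k + 1" "2 * z"] norm_triangle_ineq[of "6 * of_nat k :: complex" 1]
      a by (simp add: norm_mult) (use norm_ge_zero[of z] in linarith)
  have "norm (shifted_term k z) =
      norm (pochhammer (1/2 :: complex) k) * norm (pochhammer (1/2 - z) k) / (4 ^ k * fact k ^ 2)
      * norm (Gamma (z + of_nat k + 1/2) / Gamma (z + of_nat k + 1)) * norm (6 * of_nat k + 1 + 2 * z)"
    by (simp add: shifted_term_def shifted_base_def norm_mult norm_divide norm_power)
  also have "\<dots> \<le> fact k * pochhammer a k / (4 ^ k * fact k ^ 2) * gquot * (6 * (a + k))"
    using 1 2 3 4 a0
    by (intro mult_mono divide_right_mono mult_nonneg_nonneg divide_nonneg_nonneg pochhammer_nonneg)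
       (auto simp: pochhammer_nonneg Gamma_real_nonneg intro: pochhammer_nonneg)
  also have "\<dots> = 6 * gquot * ((a + k) * pochhammer a k) / (4 ^ k * fact k)"
    by (simp add: power2_eq_square field_simps)
  also have "(a + k) * pochhammer a k = a * pochhammer (a + 1) k"
    by (metis pochhammer_rec pochhammer_rec')
  finally show ?thesis by (simp add: power_divide mult_ac)
qed

lemma sums_pochhammer_quarter:
  "(\<lambda>k. pochhammer b k / fact k * (1/4) ^ k) sums ((4/3 :: real) powr b)"
proof -
  have "(\<lambda>k. ((- b) gchoose k) * (- 1/4) ^ k) sums ((1 + (- 1/4)) powr (- b))"
    by (rule gen_binomial_real) simp
  moreover have "((- b) gchoose k) * (- 1/4) ^ k = pochhammer b k / fact k * (1/4) ^ k" for k
  proof -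
    have "(- 1/4 :: real) ^ k = (- 1) ^ k * (1/4) ^ k"
      by (subst power_mult_distrib[symmetric]) simp
    moreover have "(- 1 :: real) ^ k * (- 1) ^ k = 1"
      by (subst power_mult_distrib[symmetric]) simp
    ultimately show ?thesis by (simp add: gbinomial_pochhammer)
  qed
  moreover have "(1 + (- 1/4)) powr (- b) = (4/3 :: real) powr b"
  proof -
    have "1 + (- 1/4) = (3/4 :: real)" by simp
    then show ?thesis by (simp only: powr_minus_divide powr_divide) simp
  qed
  ultimately show ?thesis by simp
qed

section \<open>The value of the interpolating series\<close>

definition shifted_sum :: "complex \<Rightarrow> complex" where
  "shifted_sum z = (\<Sum>k. shifted_term k z)"

lemma shifted_term_holomorphic: "shifted_term k holomorphic_on {z :: complex. - 1/4 < Re z}"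
proof -
  have "z + of_nat k + 1/2 \<notin> \<int>\<^sub>\<le>\<^sub>0" "z + of_nat k + 1 \<notin> \<int>\<^sub>\<le>\<^sub>0" if "- 1/4 < Re z" for z :: complex
    using that by (auto intro!: not_nonpos_Ints_complex_Re_pos)
  then show ?thesis
    unfolding shifted_term_def[abs_def] shifted_base_def pochhammer_prod
    by (intro holomorphic_intros) (auto simp: Gamma_eq_zero_iff)
qed

text \<open>
  The region \<open>Re z > -1/4\<close> is chosen to contain a neighbourhood of every non-negative integer,
  \<open>0\<close> included, while the Gamma factors stay bounded on it.
\<close>

lemma shifted_sum_analytic:
  assumes z: "- 1/4 < Re z"
  shows "(\<lambda>k. shifted_term k z) sums shifted_sum z"
    and "(\<lambda>k. deriv (shifted_term k) z) sums deriv shifted_sum z"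
    and "(shifted_sum has_field_derivative deriv shifted_sum z) (at z)"
proof -
  let ?D = "{z. - 1/4 < Re z}"
  define R where "R = norm z + 1"
  let ?S = "?D \<inter> ball 0 R"
  have D: "open ?D" by (rule open_halfspace_Re_gt)
  then have S: "open ?S" by auto
  have zS: "z \<in> ?S" using z by (simp add: R_def)
  let ?h = "\<lambda>k. 6 * gquot * (R + 1/2) * (pochhammer (R + 1/2 + 1) k / fact k * (1/4) ^ k)"
  obtain g g' where g: "\<forall>x\<in>?S. (\<lambda>k. shifted_term k x) sums g x \<and>
      (\<lambda>k. deriv (shifted_term k) x) sums g' x \<and> (g has_field_derivative g' x) (at x)"
  proof (rule series_and_derivative_comparison[OF S, where f=shifted_term and h="?h"
        and f'="\<lambda>k. deriv (shifted_term k)"])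
    show "summable ?h"
      using sums_pochhammer_quarter[of "R + 1/2 + 1"] by (intro summable_mult) (auto simp: sums_iff)
    show "(shifted_term k has_field_derivative deriv (shifted_term k) x) (at x)" if "x \<in> ?S" for k x
      using holomorphic_derivI[OF shifted_term_holomorphic D] that by simp
    show "\<forall>\<^sub>F k in sequentially. \<forall>x\<in>?S. norm (shifted_term k x) \<le> ?h k"
      by (intro always_eventually allI ballI norm_shifted_term_le) auto
  qed
  have eq: "g x = shifted_sum x" if "x \<in> ?S" for x
    using g that by (auto simp: shifted_sum_def sums_iff)
  have d: "(shifted_sum has_field_derivative g' z) (at z)"
    by (rule has_field_derivative_transform_within_open[OF _ S zS eq])
       (rule bspec[OF g zS, THEN conjunct2, THEN conjunct2])
  then have g'z: "deriv shifted_sum z = g' z" by (rule DERIV_imp_deriv)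
  show "(\<lambda>k. shifted_term k z) sums shifted_sum z" using bspec[OF g zS, THEN conjunct1] by (simp only: eq[OF zS])
  show "(\<lambda>k. deriv (shifted_term k) z) sums deriv shifted_sum z" using bspec[OF g zS, THEN conjunct2, THEN conjunct1] by (simp only: g'z)
  show "(shifted_sum has_field_derivative deriv shifted_sum z) (at z)" using d g'z by simp
qed

text \<open>
  The telescoped remainder is at most twice the \<open>N\<close>-th term of a convergent series.
\<close>

lemma shifted_sum_periodic:
  assumes z: "- 1/4 < Re z"
  shows "shifted_sum (z + 1) = shifted_sum z"
proof -
  have s0: "(\<lambda>k. shifted_term k z) sums shifted_sum z" by (rule shifted_sum_analytic(1)[OF z])
  have s1: "(\<lambda>k. shifted_term k (z + 1)) sums shifted_sum (z + 1)"
    using z by (intro shifted_sum_analytic(1)) simp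
  have lim: "(\<lambda>N. \<Sum>k\<le>N. shifted_term k (z + 1) - shifted_term k z)
      \<longlonglongrightarrow> shifted_sum (z + 1) - shifted_sum z"
    using sums_diff[OF s1 s0] by (simp add: sums_def_le)
  have bound: "norm (\<Sum>k\<le>N. shifted_term k (z + 1) - shifted_term k z) \<le> 2 * norm (shifted_term N z)" for N
  proof -
    have a: "norm (2 * (of_nat N + 1/2 :: complex)) \<le> 2 * norm (6 * of_nat N + 1 + 2 * z)"
    proof -
      have "norm (2 * (of_nat N + 1/2 :: complex)) = norm (complex_of_real (2 * real N + 1))"
        by (rule arg_cong[where f=norm]) simp
      also have "\<dots> = 2 * real N + 1" unfolding norm_of_real by (rule abs_of_nonneg) simp
      also have "\<dots> \<le> 2 * (6 * real N + 1 + 2 * Re z)" using z by simp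
      also have "6 * real N + 1 + 2 * Re z = Re (6 * of_nat N + 1 + 2 * z)" by simp
      finally show ?thesis
        using complex_Re_le_cmod[of "6 * of_nat N + 1 + 2 * z"] by (meson mult_left_mono order_trans zero_le_numeral)
    qed
    have b: "norm (z + of_nat N + 1/2) \<le> norm (z + of_nat N + 1)"
      using z by (auto simp: norm_complex_def intro!: power_mono real_sqrt_le_mono)
    have c: "norm (z + of_nat N + 1) > 0"
      using z not_nonpos_Ints_complex_Re_pos[of "z + of_nat N + 1"] by auto
    have "norm (shifted_base N z * (2 * (of_nat N + 1/2) * (z + of_nat N + 1/2) / (z + of_nat N + 1)))
      = norm (shifted_base N z) * (norm (2 * (of_nat N + 1/2 :: complex))
         * (norm (z + of_nat N + 1/2) / norm (z + of_nat N + 1)))"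
      by (simp add: norm_mult norm_divide)
    also have "\<dots> \<le> norm (shifted_base N z) * (2 * norm (6 * of_nat N + 1 + 2 * z) * 1)"
      using a b c by (intro mult_left_mono mult_mono) auto
    finally show ?thesis
      using z by (subst sum_shifted_term_telescopes) (simp_all add: shifted_term_def norm_mult)
  qed
  have lim0: "(\<lambda>N. 2 * norm (shifted_term N z)) \<longlonglongrightarrow> 0"
    using tendsto_mult_right_zero[OF tendsto_norm_zero[OF summable_LIMSEQ_zero[OF sums_summable[OF s0]]]] .
  have "(\<lambda>N. \<Sum>k\<le>N. shifted_term k (z + 1) - shifted_term k z) \<longlonglongrightarrow> 0"
    by (rule Lim_null_comparison[OF _ lim0]) (simp add: bound)
  from LIMSEQ_unique[OF lim this] show ?thesis by simp
qed

lemma norm_shifted_sum_le: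
  assumes z: "- 1/4 < Re z" and a: "norm z + 1/2 \<le> a"
  shows "norm (shifted_sum z) \<le> 6 * gquot * a * (4/3) powr (a + 1)"
proof -
  let ?h = "\<lambda>k. 6 * gquot * a * (pochhammer (a + 1) k / fact k * (1/4) ^ k)"
  have h: "?h sums (6 * gquot * a * (4/3) powr (a + 1))"
    by (intro sums_mult sums_pochhammer_quarter)
  have "norm (\<Sum>k. shifted_term k z) \<le> suminf ?h"
    by (rule norm_suminf_le) (use norm_shifted_term_le[of z a] z a h in \<open>auto simp: sums_iff\<close>)
  then show ?thesis using h by (simp add: shifted_sum_def sums_iff)
qed

text \<open>
  Periodicity reduces the bound to a vertical strip, where the majorant is of order
  \<open>a * (4/3) powr a\<close> with \<open>a = \<bar>Im z\<bar> + 3/2\<close>. The surplus \<open>(9/8) powr a\<close> in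
  \<open>(3/2) powr a\<close> pays for the factor \<open>a\<close>.
\<close>

lemma shifted_sum_exponential_type:
  "\<exists>C. \<forall>z. - 1/4 < Re z \<longrightarrow> norm (shifted_sum z) \<le> C * (3/2) powr \<bar>Im z\<bar>"
proof (intro exI allI impI)
  let ?K = "6 * gquot * (4/3) / ln (9/8) * (3/2) powr (3/2)"
  fix z assume z: "- 1/4 < Re z"
  define N where "N = nat \<lfloor>Re z\<rfloor>"
  define w where "w = z - of_nat N"
  have w: "- 1/4 < Re w" "Re w \<le> 1" "Im w = Im z"
    using z by (auto simp: w_def N_def) linarith+
  define a where "a = \<bar>Im z\<bar> + 3/2"
  have a: "a \<ge> 3/2" by (simp add: a_def)
  have "a * ln (9/8) \<le> exp (a * ln (9/8))"
    using exp_ge_add_one_self[of "a * ln (9/8)"] by linarith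
  then have "ln (9/8) * a \<le> (9/8) powr a" by (simp add: powr_def mult.commute)
  then have le: "a \<le> (9/8) powr a / ln (9/8)" by (simp add: field_simps)
  have g: "gquot \<ge> 0" by (simp add: Gamma_real_nonneg)
  have "shifted_sum z = shifted_sum w"
    using periodic_shift_nat[of "- 1/4" shifted_sum w N] shifted_sum_periodic w by (simp add: w_def)
  also have "norm \<dots> \<le> 6 * gquot * a * (4/3) powr (a + 1)"
    by (rule norm_shifted_sum_le[OF w(1)]) (use w cmod_le[of w] in \<open>simp add: a_def\<close>)
  also have "\<dots> = 6 * gquot * (4/3) * (4/3) powr a * a" by (simp add: powr_add)
  also have "\<dots> \<le> 6 * gquot * (4/3) * (4/3) powr a * ((9/8) powr a / ln (9/8))"
    using le g by (intro mult_left_mono) auto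
  also have "\<dots> = 6 * gquot * (4/3) / ln (9/8) * ((4/3) powr a * (9/8) powr a)" by simp
  also have "(4/3) powr a * (9/8) powr a = ((3/2) powr a :: real)"
    using powr_mult[of "4/3" "9/8" a] by simp
  also have "\<dots> = (3/2) powr (3/2) * (3/2) powr \<bar>Im z\<bar>" by (simp add: a_def powr_add mult.commute)
  finally show "norm (shifted_sum z) \<le> ?K * (3/2) powr \<bar>Im z\<bar>" by (simp add: mult.assoc)
qed

lemma Gamma_three_halves_complex: "Gamma (3/2 :: complex) = of_real (sqrt pi) / 2"
  using Gamma_plus1[of "1/2 :: complex"] not_nonpos_Ints_complex_Re_pos[of "1/2"]
  by (simp add: Gamma_one_half_complex)

text \<open>
  At \<open>z = 1/2\<close> only the term \<open>k = 0\<close> survives, which gives the value of the constant.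
\<close>

lemma shifted_sum_eq:
  assumes z: "- 1/4 < Re z"
  shows "shifted_sum z = of_real (4 / sqrt pi)"
proof -
  let ?D = "{w :: complex. - 1/4 < Re w}"
  obtain C where C: "\<And>z. - 1/4 < Re z \<Longrightarrow> norm (shifted_sum z) \<le> C * (3/2) powr \<bar>Im z\<bar>"
    using shifted_sum_exponential_type by blast
  have "shifted_sum constant_on ?D"
  proof (rule periodic_of_small_exponential_type_constant[where q="3/2" and C=C])
    show "shifted_sum holomorphic_on ?D"
      using shifted_sum_analytic(3) by (auto simp: holomorphic_on_open open_halfspace_Re_gt)
  qed (use shifted_sum_periodic C in simp_all)
  then have "shifted_sum z = shifted_sum (1/2)" using z unfolding constant_on_def by force
  also have "shifted_sum (1/2) = shifted_term 0 (1/2)"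
  proof -
    have "shifted_term k (1/2 :: complex) = 0" if "k \<notin> {0}" for k
      using that by (simp add: shifted_term_def shifted_base_def pochhammer_0_left)
    then have "(\<Sum>k. shifted_term k (1/2 :: complex)) = (\<Sum>k\<in>{0}. shifted_term k (1/2))"
      by (intro suminf_finite) auto
    then show ?thesis by (simp add: shifted_sum_def)
  qed
  also have "\<dots> = of_real (4 / sqrt pi)"
    by (simp add: shifted_term_def shifted_base_def Gamma_three_halves_complex)
  finally show ?thesis .
qed

section \<open>Derivatives and harmonic numbers\<close>

lemma half_integer_not_in_Ints: "of_int j + 1/2 \<notin> (\<int> :: 'a :: field_char_0 set)"
proof
  assume "of_int j + 1/2 \<in> (\<int> :: 'a set)"
  then obtain i where "of_int j + 1/2 = (of_int i :: 'a)" by (auto elim: Ints_cases)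
  then have "of_int (2 * j + 1) = (of_int (2 * i) :: 'a)" by (simp add: field_simps)
  then have "2 * j + 1 = 2 * i" by (simp only: of_int_eq_iff)
  then show False by presburger
qed

lemma half_minus_nat_not_nonpos_Ints: "1/2 - of_nat n \<notin> (\<int>\<^sub>\<le>\<^sub>0 :: 'a :: field_char_0 set)"
  using half_integer_not_in_Ints[of "- int n", where 'a='a] nonpos_Ints_subset_Ints by auto

text \<open>
  Logarithmic differentiation; away from the poles the Pochhammer symbol in \<open>x\<close> is a quotient of
  two values of the Gamma function.
\<close>

lemma has_field_derivative_shifted_base:
  fixes x :: complex
  assumes x: "- 1/2 < Re x" and half: "1/2 - x \<notin> \<int>\<^sub>\<le>\<^sub>0"
  shows "(shifted_base k has_field_derivative shifted_base k x *
     (Digamma (x + of_nat k + 1/2) - Digamma (x + of_nat k + 1)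
      - Digamma (1/2 - x + of_nat k) + Digamma (1/2 - x))) (at x)"
proof -
  define c :: complex where "c = pochhammer (1/2) k / (4 ^ k * fact k ^ 2)"
  let ?S = "{y :: complex. 1/2 - y \<notin> \<int>\<^sub>\<le>\<^sub>0}"
  have nonpos: "1/2 - y + of_nat k \<notin> \<int>\<^sub>\<le>\<^sub>0" if "1/2 - y \<notin> \<int>\<^sub>\<le>\<^sub>0" for y :: complex
  proof
    assume "1/2 - y + of_nat k \<in> \<int>\<^sub>\<le>\<^sub>0"
    then obtain m where "1/2 - y + of_nat k = - of_nat m" by (elim nonpos_Ints_cases')
    then have "1/2 - y = - of_nat (m + k)" by (simp add: algebra_simps)
    then show False using that by (metis minus_of_nat_in_nonpos_Ints)
  qed
  have "open ((\<lambda>y :: complex. 1/2 - y) -` (- \<int>\<^sub>\<le>\<^sub>0))"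
    by (intro open_vimage continuous_intros) (simp add: open_Compl closed_nonpos_Ints)
  then have op: "open ?S" by (simp add: vimage_def)
  have ne: "x + of_nat k + 1/2 \<notin> \<int>\<^sub>\<le>\<^sub>0" "x + of_nat k + 1 \<notin> \<int>\<^sub>\<le>\<^sub>0"
    using x by (auto intro!: not_nonpos_Ints_complex_Re_pos)
  let ?f = "\<lambda>y. c * (Gamma (1/2 - y + of_nat k) / Gamma (1/2 - y))
      * (Gamma (y + of_nat k + 1/2) / Gamma (y + of_nat k + 1))"
  have "(?f has_field_derivative ?f x *
     (Digamma (x + of_nat k + 1/2) - Digamma (x + of_nat k + 1)
      - Digamma (1/2 - x + of_nat k) + Digamma (1/2 - x))) (at x)"
  proof -
    have Gamma: "((\<lambda>y. Gamma (y + u)) has_field_derivative Gamma (x + u) * Digamma (x + u)) (at x)"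
      if "x + u \<notin> \<int>\<^sub>\<le>\<^sub>0" for u :: complex
      by (rule derivative_eq_intros that refl)+ simp
    have Gamma': "((\<lambda>y. Gamma (u - y)) has_field_derivative - (Gamma (u - x) * Digamma (u - x))) (at x)"
      if "u - x \<notin> \<int>\<^sub>\<le>\<^sub>0" for u :: complex
      by (rule derivative_eq_intros that refl)+ simp
    have quotients:
      "((\<lambda>y. p y / q y * (r y / s y)) has_field_derivative p x / q x * (r x / s x) * (c - d - a + b)) (at x)"
      if "(p has_field_derivative - (p x * a)) (at x)" "(q has_field_derivative - (q x * b)) (at x)"
         "(r has_field_derivative r x * c) (at x)" "(s has_field_derivative s x * d) (at x)"
         "q x \<noteq> 0" "s x \<noteq> 0"
      for p q r s :: "complex \<Rightarrow> complex" and a b c d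
      by (rule DERIV_cong[OF DERIV_mult[OF DERIV_divide[OF that(1,2,5)] DERIV_divide[OF that(3,4,6)]]])
         (use that(5,6) in \<open>simp add: field_simps\<close>)
    have G0: "Gamma (1/2 - x) \<noteq> 0" "Gamma (x + of_nat k + 1) \<noteq> 0"
      using half ne by (simp_all add: Gamma_eq_zero_iff)
    have "((\<lambda>y. Gamma (1/2 - y + of_nat k) / Gamma (1/2 - y) * (Gamma (y + of_nat k + 1/2) / Gamma (y + of_nat k + 1)))
       has_field_derivative Gamma (1/2 - x + of_nat k) / Gamma (1/2 - x)
         * (Gamma (x + of_nat k + 1/2) / Gamma (x + of_nat k + 1)) * D) (at x)"
      if "D = Digamma (x + of_nat k + 1/2) - Digamma (x + of_nat k + 1)
      - Digamma (1/2 - x + of_nat k) + Digamma (1/2 - x)" for D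
      unfolding that
      by (rule quotients)
         (use Gamma[of "of_nat k + 1/2"] Gamma[of "of_nat k + 1"] Gamma'[of "1/2 + of_nat k"] Gamma'[of "1/2"]
            ne half nonpos[OF half] G0 in \<open>simp_all add: add.assoc[symmetric] diff_add_eq\<close>)
    from DERIV_cmult[OF this[OF refl], of c] show ?thesis by (simp add: mult.assoc)
  qed
  moreover have eq: "?f y = shifted_base k y" if "y \<in> ?S" for y
    using that by (simp add: shifted_base_def c_def pochhammer_Gamma)
  ultimately have "(?f has_field_derivative shifted_base k x *
     (Digamma (x + of_nat k + 1/2) - Digamma (x + of_nat k + 1)
      - Digamma (1/2 - x + of_nat k) + Digamma (1/2 - x))) (at x)"
    using half by (metis (no_types, lifting) mem_Collect_eq)
  then show ?thesis
    by (rule has_field_derivative_transform_within_open[OF _ op _ eq]) (use half in simp_all)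
qed

lemma deriv_shifted_term:
  fixes x :: complex
  assumes x: "- 1/2 < Re x" and half: "1/2 - x \<notin> \<int>\<^sub>\<le>\<^sub>0"
  shows "deriv (shifted_term k) x = shifted_base k x *
     ((6 * of_nat k + 1 + 2 * x) * (Digamma (x + of_nat k + 1/2) - Digamma (x + of_nat k + 1)
      - Digamma (1/2 - x + of_nat k) + Digamma (1/2 - x)) + 2)"
  unfolding shifted_term_def[abs_def]
  by (rule DERIV_imp_deriv)
     (rule derivative_eq_intros has_field_derivative_shifted_base[OF x half] refl
      | simp add: algebra_simps)+

text \<open>
  One formula covers both signs of \<open>j\<close>: for negative \<open>j\<close> it is the definition.
\<close>

lemma two_odd_harm_eq_Digamma:
  "2 * odd_harm j = Digamma (of_int j + 1/2) + euler_mascheroni + 2 * ln 2"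
proof (cases "j \<ge> 0")
  case True
  have "(\<Sum>i=1..n. 1 / (2 * real i - 1)) = (\<Sum>i<n. 1 / (2 * real i + 1))" for n
    by (induction n) auto
  then have "2 * odd_harm j = (\<Sum>i<nat j. 2 / (of_nat (2 * i + 1)))"
    using True by (simp add: odd_harm_def sum_distrib_left add.commute)
  then show ?thesis
    using True Digamma_half_integer[of "nat j", where 'a=real] by simp
next
  case False
  then show ?thesis by (simp add: odd_harm_def harmonic_def algebra_simps)
qed

text \<open>
  This is the symmetry of \<open>odd_harm\<close> under \<open>j \<mapsto> - j\<close>.
\<close>

lemma Digamma_reflect_half: "Digamma (1/2 - real n) = Digamma (real n + 1/2)"
proof (induction n)
  case (Suc n)
  have "1/2 - real (Suc n) \<noteq> 0" by linarith
  moreover have "1 / (1/2 - real (Suc n)) = - (1 / (real n + 1/2))"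
  proof -
    have "1/2 - real (Suc n) = - (real n + 1/2)" by simp
    then show ?thesis by (simp only: divide_minus_right)
  qed
  moreover have "1/2 - real (Suc n) + 1 = 1/2 - real n" "real n + 1/2 + 1 = real (Suc n) + 1/2" by simp_all
  ultimately show ?case
    using Suc Digamma_plus1[of "1/2 - real (Suc n)"] Digamma_plus1[of "real n + 1/2"] by simp
qed simp

lemma Gamma_half_minus_nat: "Gamma (1/2 - real n) = (-1) ^ n * sqrt pi / pochhammer (1/2) n"
proof (induction n)
  case 0 then show ?case by (simp add: Gamma_one_half_real)
next
  case (Suc n)
  from Gamma_plus1[OF half_minus_nat_not_nonpos_Ints[of "Suc n", where 'a=real]]
  have "Gamma (1/2 - real n) = (- 1/2 - real n) * Gamma (1/2 - real (Suc n))"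
    by simp
  moreover have "- 1/2 - real n = - (1/2 + real n)" by simp
  ultimately have "Gamma (1/2 - real (Suc n)) = - (Gamma (1/2 - real n) / (1/2 + real n))"
    by (simp only: minus_mult_left[symmetric] minus_divide_left) (simp add: add_eq_0_iff)
  then show ?case unfolding Suc.IH by (simp add: pochhammer_rec')
qed

text \<open>
  Both sides are multiplied by \<open>2 * (k + n + 1/2) / ((k - n - 1/2) * (k + n + 1))\<close> when \<open>n\<close>
  increases by one.
\<close>

lemma summand_weight_eq_shifted_base:
  "pochhammer (1/2 :: real) k ^ 3 / (4 ^ k * fact k ^ 3)
     * ((\<Prod>j=1..2 * n. 2 * real k + real j)
          / (\<Prod>j=1..n. (real k + real j)\<^sup>2 * (2 * real k - 2 * real j + 1)))
   = 2 ^ n * Gamma (1/2 - real n) / pi * shifted_base k (real n)"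
proof (induction n)
  case 0
  have "Gamma (real k + 1/2) = pochhammer (1/2) k * sqrt pi"
    using pochhammer_Gamma[of "1/2 :: real" k] half_minus_nat_not_nonpos_Ints[of 0, where 'a=real] by (simp add: Gamma_one_half_real add.commute)
  moreover have "Gamma (real k + 1) = fact k"
    using Gamma_fact[of k, where 'a=real] by (simp add: add.commute)
  moreover have ss: "sqrt pi * (sqrt pi * y) = pi * y" for y
    by (simp flip: mult.assoc)
  ultimately show ?case
    by (simp add: ss shifted_base_def Gamma_one_half_real power2_eq_square power3_eq_cube mult_ac)
next
  case (Suc n)
  define x where "x = real n"
  have pos: "x + k + 1/2 > 0" "x + k + 1 > 0" by (simp_all add: x_def)
  have nz: "real k - 1/2 - x \<noteq> 0"
  proof
    assume "real k - 1/2 - x = 0"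
    then have "of_int (int k - int n - 1) + 1/2 = (0 :: real)" by (simp add: x_def)
    then show False using half_integer_not_in_Ints[of "int k - int n - 1", where 'a=real] by (metis Ints_0)
  qed
  have u: "x + k + 1/2 \<notin> \<int>\<^sub>\<le>\<^sub>0" "x + k + 1 \<notin> \<int>\<^sub>\<le>\<^sub>0" using pos by (auto elim!: nonpos_Ints_cases)
  have p: "pochhammer (1/2 - (x + 1)) k * (k - 1/2 - x) = (- 1/2 - x) * pochhammer (1/2 - x) k"
    using pochhammer_rec[of "1/2 - (x + 1)" k] pochhammer_rec'[of "1/2 - (x + 1)" k]
    by (simp add: algebra_simps)
  have G: "Gamma (1/2 - x) = (- 1/2 - x) * Gamma (1/2 - (x + 1))"
    using Gamma_plus1[OF half_minus_nat_not_nonpos_Ints[of "Suc n", where 'a=real]] by (simp add: x_def add_ac)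
  define R where "R = (x + k + 1/2) / ((k - 1/2 - x) * (x + k + 1))"
  have base_step: "Gamma (1/2 - (x + 1)) * shifted_base k (x + 1)
     = Gamma (1/2 - x) * shifted_base k x * R"
  proof -
    have p': "pochhammer (1/2 - (x + 1)) k = (- 1/2 - x) * pochhammer (1/2 - x) k / (k - 1/2 - x)"
      using p nz by (simp add: field_simps)
    have g: "Gamma (x + 1 + k + 1/2) = (x + k + 1/2) * Gamma (x + k + 1/2)"
       "Gamma (x + 1 + k + 1) = (x + k + 1) * Gamma (x + k + 1)"
      using Gamma_plus1[OF u(1)] Gamma_plus1[OF u(2)] by (simp_all add: add_ac)
    show ?thesis unfolding R_def shifted_base_def p' g G by (simp add: mult_ac)
  qed
  have prod_step: "(\<Prod>j=1..2 * Suc n. 2 * real k + real j)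
      / (\<Prod>j=1..Suc n. (real k + real j)\<^sup>2 * (2 * real k - 2 * real j + 1))
    = (\<Prod>j=1..2 * n. 2 * real k + real j)
      / (\<Prod>j=1..n. (real k + real j)\<^sup>2 * (2 * real k - 2 * real j + 1))
      * (2 * R)" (is "?A = ?B * ?r")
  proof -
    have "?A = ?B * ((2 * k + (2 * x + 1)) * (2 * k + (2 * x + 2)) / ((k + (x + 1))\<^sup>2 * (2 * k - 2 * (x + 1) + 1)))"
      by (simp add: x_def add_ac)
    also have "(2 * k + (2 * x + 1)) * (2 * k + (2 * x + 2)) / ((k + (x + 1))\<^sup>2 * (2 * k - 2 * (x + 1) + 1)) = ?r"
    proof -
      have f: "2 * k + (2 * x + 1) = 2 * (x + k + 1/2)" "2 * k + (2 * x + 2) = 2 * (x + k + 1)"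
        "k + (x + 1) = x + k + 1" "2 * k - 2 * (x + 1) + 1 = 2 * (k - 1/2 - x)"
        by simp_all
      have "2 * u * (2 * v) / (v\<^sup>2 * (2 * w)) = 2 * (u / (w * v))" if "v \<noteq> 0" "w \<noteq> 0" for u v w :: real
        using that by (simp add: power2_eq_square)
      from this[of "x + k + 1" "k - 1/2 - x" "x + k + 1/2"] show ?thesis
        unfolding f R_def using pos nz by simp
    qed
    finally show ?thesis .
  qed
  let ?c = "pochhammer (1/2 :: real) k ^ 3 / (4 ^ k * fact k ^ 3)"
  have "?c * ?A = (?c * ?B) * (2 * R)" by (simp only: prod_step mult.assoc)
  also have "\<dots> = 2 ^ n * Gamma (1/2 - x) / pi * shifted_base k x * (2 * R)"
    by (simp only: Suc.IH x_def)
  also have "\<dots> = 2 ^ Suc n * (Gamma (1/2 - x) * shifted_base k x * R) / pi" by simp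
  also have "\<dots> = 2 ^ Suc n * Gamma (1/2 - (x + 1)) / pi * shifted_base k (x + 1)"
    unfolding base_step[symmetric] by simp
  also have "x + 1 = real (Suc n)" by (simp add: x_def)
  finally show ?case .
qed

lemma shifted_base_of_real: "shifted_base k (complex_of_real x) = of_real (shifted_base k x)"
proof -
  have "pochhammer (1/2 - complex_of_real x) k = of_real (pochhammer (1/2 - x) k)"
    by (simp flip: pochhammer_of_real)
  moreover have "pochhammer (1/2 :: complex) k = of_real (pochhammer (1/2) k)"
    by (simp flip: pochhammer_of_real)
  moreover have "Gamma (complex_of_real x + of_nat k + 1/2) = of_real (Gamma (x + of_nat k + 1/2))"
    "Gamma (complex_of_real x + of_nat k + 1) = of_real (Gamma (x + of_nat k + 1))"
    by (simp_all flip: Gamma_complex_of_real)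
  ultimately show ?thesis by (simp add: shifted_base_def)
qed


lemma sum_deriv_shifted_term:
  "(\<lambda>k. deriv (shifted_term k) (complex_of_nat n)) sums 0"
proof -
  have "deriv shifted_sum (complex_of_nat n) = 0"
  proof (rule DERIV_imp_deriv)
    show "(shifted_sum has_field_derivative 0) (at (complex_of_nat n))"
      by (rule has_field_derivative_transform_within_open[where f="\<lambda>_. of_real (4 / sqrt pi)"
            and S="{w. - 1/4 < Re w}"])
         (simp_all add: shifted_sum_eq open_halfspace_Re_gt)
  qed
  then show ?thesis using shifted_sum_analytic(2)[of "complex_of_nat n"] by simp
qed

text \<open>
  The summand is \<open>d * shifted_term k n\<close> minus the derivative of \<open>shifted_term k\<close> at \<open>n\<close>, where
  \<open>d\<close> cancels the contribution of \<open>Digamma (1/2 - n)\<close> and the multiple of Euler's constant that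
  is left when the other Digamma values are written as harmonic numbers. The derivatives sum to zero and the terms sum to \<open>4 / sqrt pi\<close>.
\<close>

lemma digamma_weighted_sum:
  "(\<lambda>k. shifted_base k (real n) * ((6 * real k + 1 + 2 * real n)
        * (2 * odd_harm (int k - int n) - 2 * odd_harm (int k + int n) + harm (k + n)) - 2))
    sums (2 * (odd_harm (int n) - ln 2) * (4 / sqrt pi))"
proof -
  let ?x = "complex_of_nat n"
  let ?\<gamma> = "euler_mascheroni :: real"
  define d :: real where "d = ?\<gamma> + Digamma (1/2 - real n)"
  have d: "d = 2 * (odd_harm (int n) - ln 2)"
    using two_odd_harm_eq_Digamma[of "int n"] Digamma_reflect_half[of n] by (simp add: d_def)
  have summand: "of_real d * shifted_term k ?x - deriv (shifted_term k) ?x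
     = of_real (shifted_base k (real n) * ((6 * real k + 1 + 2 * real n)
        * (2 * odd_harm (int k - int n) - 2 * odd_harm (int k + int n) + harm (k + n)) - 2))"
    (is "_ = of_real (?b * (?m * ?h - 2))") for k
  proof -
    have Dig: "Digamma (complex_of_real y) = of_real (Digamma y)" if "y \<notin> \<int>\<^sub>\<le>\<^sub>0" for y
      using that by (intro Polygamma_of_real) auto
    have b: "shifted_base k ?x = of_real ?b" using shifted_base_of_real[of k "real n"] by simp
    have nonpos: "of_int j + 1/2 \<notin> (\<int>\<^sub>\<le>\<^sub>0 :: real set)" for j
      using half_integer_not_in_Ints[of j, where 'a=real] nonpos_Ints_subset_Ints by blast
    have h1: "Digamma (?x + of_nat k + 1/2) = of_real (2 * odd_harm (int k + int n) - ?\<gamma> - 2 * ln 2)"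
      using Dig[OF nonpos[of "int k + int n"]] two_odd_harm_eq_Digamma[of "int k + int n"] by (simp add: add_ac)
    have h2: "Digamma (1/2 - ?x + of_nat k) = of_real (2 * odd_harm (int k - int n) - ?\<gamma> - 2 * ln 2)"
      using Dig[OF nonpos[of "int k - int n"]] two_odd_harm_eq_Digamma[of "int k - int n"] by (simp add: algebra_simps)
    have h3: "Digamma (?x + of_nat k + 1) = of_real (harm (k + n) - ?\<gamma>)"
      using Digamma_of_nat[of "k + n", where 'a=complex] by (simp add: of_real_harm add_ac)
    have h4: "Digamma (1/2 - ?x) = of_real (d - ?\<gamma>)"
      using Dig[OF half_minus_nat_not_nonpos_Ints[of n]] by (simp add: d_def)
    have D: "deriv (shifted_term k) ?x = of_real (?b * (?m * (d - ?h) + 2))"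
      using half_minus_nat_not_nonpos_Ints[of n, where 'a=complex]
      by (subst deriv_shifted_term) (simp_all add: h1 h2 h3 h4 b)
    have T: "shifted_term k ?x = of_real (?b * ?m)" by (simp add: shifted_term_def b)
    show ?thesis unfolding D T of_real_mult[symmetric] of_real_diff[symmetric]
      by (simp only: of_real_eq_iff) (simp add: algebra_simps)
  qed
  have "(\<lambda>k. of_real d * shifted_term k ?x - deriv (shifted_term k) ?x)
      sums (of_real d * of_real (4 / sqrt pi) - 0)"
    using shifted_sum_analytic(1)[of ?x] shifted_sum_eq[of ?x]
    by (intro sums_diff sums_mult sum_deriv_shifted_term) auto
  then show ?thesis
    unfolding summand unfolding d[symmetric]
    by (simp only: diff_0_right of_real_mult[symmetric] sums_of_real_iff)
qed

section \<open>The series with harmonic numbers\<close>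

theorem corollary8:
  shows "(\<forall>n :: nat.
    (\<lambda>k :: nat.
       (pochhammer (1 / 2 :: real) k) ^ 3 / (4 ^ k * (fact k) ^ 3)
       * ((\<Prod>j=1..2 * n. 2 * real k + real j)
          / (\<Prod>j=1..n. (real k + real j)\<^sup>2 * (2 * real k - 2 * real j + 1)))
       * ((6 * real k + 1 + 2 * real n)
            * (2 * odd_harm (int k - int n) - 2 * odd_harm (int k + int n) + harm (k + n)) - 2))
    sums ((-1) ^ n * (2 ^ (n + 3) / pochhammer (1 / 2) n) * (odd_harm (int n) - ln 2) * (1 / pi)))
  \<and> (\<lambda>k :: nat.
       (pochhammer (1 / 2 :: real) k) ^ 3 / (4 ^ k * (fact k) ^ 3)
       * ((6 * real k + 1) * harm k - 2))
    sums (- (8 * ln 2 / pi))" (is "(\<forall>n. ?sums n) \<and> _")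
proof
  show all: "\<forall>n. ?sums n"
  proof
    fix n :: nat
    have "2 ^ n * Gamma (1/2 - real n) / pi * (2 * (odd_harm (int n) - ln 2) * (4 / sqrt pi))
      = (-1) ^ n * (2 ^ (n + 3) / pochhammer (1 / 2) n) * (odd_harm (int n) - ln 2) * (1 / pi)"
      by (simp add: Gamma_half_minus_nat power_add)
    then show "?sums n"
      using sums_mult[OF digamma_weighted_sum[of n], of "2 ^ n * Gamma (1/2 - real n) / pi"]
      unfolding summand_weight_eq_shifted_base by (simp only: mult.assoc)
  qed
  have "odd_harm 0 = 0" by (simp add: odd_harm_def)
  with spec[OF all, of 0] show "(\<lambda>k :: nat.
       (pochhammer (1 / 2 :: real) k) ^ 3 / (4 ^ k * (fact k) ^ 3)
       * ((6 * real k + 1) * harm k - 2))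
    sums (- (8 * ln 2 / pi))"
    by simp
qed

end
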